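(* Let $q$ be a spacelike split quaternion, written in the form $q=N_q(\sinh\theta+\overrightarrow{\varepsilon}\cosh\theta)$, where $\theta\in\mathbb{R}$ and $\overrightarrow{\varepsilon}=(u_1,u_2,u_3)=u_1i+u_2j+u_3k$ is a spacelike unit vector in $\mathbb{E}_1^3$. Let $n$ be a positive integer. If $n$ is odd, then $$(\mathbf{L}_q)^n=(N_q)^n\begin{bmatrix}\sinh n\theta&-u_1\cosh n\theta&u_2\cosh n\theta&u_3\cosh n\theta\\ u_1\cosh n\theta&\sinh n\theta&u_3\cosh n\theta&-u_2\cosh n\theta\\ u_2\cosh n\theta&u_3\cosh n\theta&\sinh n\theta&-u_1\cosh n\theta\\ u_3\cosh n\theta&-u_2\cosh n\theta&u_1\cosh n\theta&\sinh n\theta\end{bmatrix}=(N_q)^n[\sinh n\theta\,\mathbf{I}_4+\cosh n\theta\,\mathbf{L}_{\overrightarrow{\varepsilon}}],$$ $$(\mathbf{R}_q)^n=(N_q)^n\begin{bmatrix}\sinh n\theta&-u_1\cosh n\theta&u_2\cosh n\theta&u_3\cosh n\theta\\ u_1\cosh n\theta&\sinh n\theta&-u_3\cosh n\theta&u_2\cosh n\theta\\ u_2\cosh n\theta&-u_3\cosh n\theta&\sinh n\theta&u_1\cosh n\theta\\ u_3\cosh n\theta&u_2\cosh n\theta&-u_1\cosh n\theta&\sinh n\theta\end{bmatrix}=(N_q)^n[\sinh n\theta\,\mathbf{I}_4+\cosh n\theta\,\mathbf{R}_{\overrightarrow{\varepsilon}}].$$ If $n$ is even, then $$(\mathbf{L}_q)^n=(N_q)^n\begin{bmatrix}\cosh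 n\theta&-u_1\sinh n\theta&u_2\sinh n\theta&u_3\sinh n\theta\\ u_1\sinh n\theta&\cosh n\theta&u_3\sinh n\theta&-u_2\sinh n\theta\\ u_2\sinh n\theta&u_3\sinh n\theta&\cosh n\theta&-u_1\sinh n\theta\\ u_3\sinh n\theta&-u_2\sinh n\theta&u_1\sinh n\theta&\cosh n\theta\end{bmatrix}=(N_q)^n[\cosh n\theta\,\mathbf{I}_4+\sinh n\theta\,\mathbf{L}_{\overrightarrow{\varepsilon}}],$$ $$(\mathbf{R}_q)^n=(N_q)^n\begin{bmatrix}\cosh n\theta&-u_1\sinh n\theta&u_2\sinh n\theta&u_3\sinh n\theta\\ u_1\sinh n\theta&\cosh n\theta&-u_3\sinh n\theta&u_2\sinh n\theta\\ u_2\sinh n\theta&-u_3\sinh n\theta&\cosh n\theta&u_1\sinh n\theta\\ u_3\sinh n\theta&u_2\sinh n\theta&-u_1\sinh n\theta&\cosh n\theta\end{bmatrix}=(N_q)^n[\cosh n\theta\,\mathbf{I}_4+\sinh n\theta\,\mathbf{R}_{\overrightarrow{\varepsilon}}].$$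
   Context: The split quaternions $\widehat{\mathbb{H}}$ form the real associative algebra with basis $\{1,i,j,k\}$ and products $i^2=-1$, $j^2=k^2=1$, $ij=k=-ji$, $jk=-i=-kj$, $ki=j=-ik$. For $q=q_0+q_1i+q_2j+q_3k$, put $I_q=q_0^2+q_1^2-q_2^2-q_3^2$ and $N_q=\sqrt{|I_q|}$. The split quaternion $q$ is timelike if $I_q>0$, spacelike if $I_q<0$, lightlike if $I_q=0$. Pure split quaternions (those with $q_0=0$) $u_1i+u_2j+u_3k$ are identified with vectors $(u_1,u_2,u_3)$ of Minkowski 3-space $\mathbb{E}_1^3$, i.e. $\mathbb{R}^3$ with $\langle u,v\rangle_{\mathbb{L}}=-u_1v_1+u_2v_2+u_3v_3$. A vector $u$ is spacelike if $\langle u,u\rangle_{\mathbb{L}}>0$; a spacelike unit vector satisfies $\langle u,u\rangle_{\mathbb{L}}=1$. The left and right matrix representations of $q$ (matrices of $p\mapsto qp$ and $p\mapsto pq$ in the basis $1,i,j,k$) are $$\mathbf{L}_q=\begin{bmatrix}q_0&-q_1&q_2&q_3\\ q_1&q_0&q_3&-q_2\\ q_2&q_3&q_0&-q_1\\ q_3&-q_2&q_1&q_0\end{bmatrix},\qquad \mathbf{R}_q=\begin{bmatrix}q_0&-q_1&q_2&q_3\\ q_1&q_0&-q_3&q_2\\ q_2&-q_3&q_0&q_1\\ q_3&q_2&-q_1&q_0\end{bmatrix}.$$ $\mathbf{I}_4$ is the $4\times4$ identity matrix. *)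

theory Defs
  imports "HOL-Analysis.Analysis"
begin

section \<open>Split quaternions\<close>

datatype split_quat = SQuat (sq0: real) (sq1: real) (sq2: real) (sq3: real)

lemma split_quat_eq_iff:
  "p = q \<longleftrightarrow> sq0 p = sq0 q \<and> sq1 p = sq1 q \<and> sq2 p = sq2 q \<and> sq3 p = sq3 q"
  by (cases p; cases q) simp

instantiation split_quat :: real_algebra_1
begin

definition zero_split_quat :: split_quat
  where "0 = SQuat 0 0 0 0"

definition one_split_quat :: split_quat
  where "1 = SQuat 1 0 0 0"

definition plus_split_quat :: "split_quat \<Rightarrow> split_quat \<Rightarrow> split_quat"
  where "p + q = SQuat (sq0 p + sq0 q) (sq1 p + sq1 q) (sq2 p + sq2 q) (sq3 p + sq3 q)"

definition minus_split_quat :: "split_quat \<Rightarrow> split_quat \<Rightarrow> split_quat"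
  where "p - q = SQuat (sq0 p - sq0 q) (sq1 p - sq1 q) (sq2 p - sq2 q) (sq3 p - sq3 q)"

definition uminus_split_quat :: "split_quat \<Rightarrow> split_quat"
  where "- q = SQuat (- sq0 q) (- sq1 q) (- sq2 q) (- sq3 q)"

definition scaleR_split_quat :: "real \<Rightarrow> split_quat \<Rightarrow> split_quat"
  where "scaleR r q = SQuat (r * sq0 q) (r * sq1 q) (r * sq2 q) (r * sq3 q)"

text \<open>The bilinear extension of the multiplication table of the basis \<open>1, i, j, k\<close>,
  which is verified in \<open>split_quat_basis_products\<close> below.\<close>

definition times_split_quat :: "split_quat \<Rightarrow> split_quat \<Rightarrow> split_quat"
  where "p * q = SQuat
    (sq0 p * sq0 q - sq1 p * sq1 q + sq2 p * sq2 q + sq3 p * sq3 q)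
    (sq0 p * sq1 q + sq1 p * sq0 q - sq2 p * sq3 q + sq3 p * sq2 q)
    (sq0 p * sq2 q + sq2 p * sq0 q - sq1 p * sq3 q + sq3 p * sq1 q)
    (sq0 p * sq3 q + sq3 p * sq0 q + sq1 p * sq2 q - sq2 p * sq1 q)"

lemmas split_quat_defs =
  zero_split_quat_def one_split_quat_def plus_split_quat_def minus_split_quat_def
  uminus_split_quat_def scaleR_split_quat_def times_split_quat_def

instance
  by standard (simp_all add: split_quat_eq_iff split_quat_defs algebra_simps)

end

definition sq_i :: split_quat where "sq_i = SQuat 0 1 0 0"
definition sq_j :: split_quat where "sq_j = SQuat 0 0 1 0"
definition sq_k :: split_quat where "sq_k = SQuat 0 0 0 1"

lemma split_quat_basis_products:
  "sq_i * sq_i = - 1" "sq_j * sq_j = 1" "sq_k * sq_k = 1"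
  "sq_i * sq_j = sq_k" "sq_j * sq_i = - sq_k"
  "sq_j * sq_k = - sq_i" "sq_k * sq_j = sq_i"
  "sq_k * sq_i = sq_j" "sq_i * sq_k = - sq_j"
  by (simp_all add: sq_i_def sq_j_def sq_k_def split_quat_defs)

lemma SQuat_expand:
  "SQuat a b c d = of_real a + b *\<^sub>R sq_i + c *\<^sub>R sq_j + d *\<^sub>R sq_k"
  by (simp add: of_real_def sq_i_def sq_j_def sq_k_def split_quat_defs)

definition sq_I :: "split_quat \<Rightarrow> real"
  where "sq_I q = (sq0 q)\<^sup>2 + (sq1 q)\<^sup>2 - (sq2 q)\<^sup>2 - (sq3 q)\<^sup>2"

definition sq_N :: "split_quat \<Rightarrow> real"
  where "sq_N q = sqrt \<bar>sq_I q\<bar>"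

text \<open>For a split quaternion, spacelike means \<open>I\<^sub>q < 0\<close>; this differs from the
  condition \<open>\<langle>u, u\<rangle> > 0\<close> on vectors only by the sign convention, since \<open>I\<^sub>u = - \<langle>u, u\<rangle>\<close>
  for pure \<open>u\<close>.\<close>

definition sq_spacelike :: "split_quat \<Rightarrow> bool"
  where "sq_spacelike q \<longleftrightarrow> sq_I q < 0"


section \<open>Minkowski 3-space\<close>

definition lorentz_inner :: "real^3 \<Rightarrow> real^3 \<Rightarrow> real"
  where "lorentz_inner u v = - (u$1 * v$1) + u$2 * v$2 + u$3 * v$3"

definition spacelike_unit :: "real^3 \<Rightarrow> bool"
  where "spacelike_unit u \<longleftrightarrow> lorentz_inner u u = 1"

definition pure_sq :: "real^3 \<Rightarrow> split_quat"
  where "pure_sq u = u$1 *\<^sub>R sq_i + u$2 *\<^sub>R sq_j + u$3 *\<^sub>R sq_k"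

lemma pure_sq_eq: "pure_sq u = SQuat 0 (u$1) (u$2) (u$3)"
  by (simp add: pure_sq_def sq_i_def sq_j_def sq_k_def split_quat_defs)

lemma sq_I_pure: "sq_I (pure_sq u) = - lorentz_inner u u"
  by (simp add: sq_I_def pure_sq_eq lorentz_inner_def power2_eq_square)


section \<open>Matrix representations\<close>

abbreviation matrix44 :: "real list list \<Rightarrow> real^4^4"
  where "matrix44 rs \<equiv> vector (map vector rs)"

definition sq_L :: "split_quat \<Rightarrow> real^4^4"
  where "sq_L q = matrix44
   [[sq0 q, - sq1 q,   sq2 q,   sq3 q],
    [sq1 q,   sq0 q,   sq3 q, - sq2 q],
    [sq2 q,   sq3 q,   sq0 q, - sq1 q],
    [sq3 q, - sq2 q,   sq1 q,   sq0 q]]"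

definition sq_R :: "split_quat \<Rightarrow> real^4^4"
  where "sq_R q = matrix44
   [[sq0 q, - sq1 q,   sq2 q,   sq3 q],
    [sq1 q,   sq0 q, - sq3 q,   sq2 q],
    [sq2 q, - sq3 q,   sq0 q,   sq1 q],
    [sq3 q,   sq2 q, - sq1 q,   sq0 q]]"

text \<open>The library's \<open>^\<close> on the type \<open>'a^'n^'n\<close> is the entrywise power,
  so powers with respect to the matrix product \<open>**\<close> are defined here.\<close>

primrec matrix_power :: "'a::semiring_1^'n^'n \<Rightarrow> nat \<Rightarrow> 'a^'n^'n"
  where
    "matrix_power A 0 = mat 1"
  | "matrix_power A (Suc n) = A ** matrix_power A n"

definition sq_coords :: "split_quat \<Rightarrow> real^4"
  where "sq_coords q = vector [sq0 q, sq1 q, sq2 q, sq3 q]"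

lemma vector_4:
  "(vector [x, y, z, w] :: 'a::zero^4) $ 1 = x"
  "(vector [x, y, z, w] :: 'a::zero^4) $ 2 = y"
  "(vector [x, y, z, w] :: 'a::zero^4) $ 3 = z"
  "(vector [x, y, z, w] :: 'a::zero^4) $ 4 = w"
  by (simp_all add: vector_def)

lemma sq_L_represents: "sq_L q *v sq_coords p = sq_coords (q * p)"
  by (simp add: vec_eq_iff forall_4 matrix_vector_mult_def sum_4 sq_L_def sq_coords_def
      vector_4 times_split_quat_def algebra_simps)

lemma sq_R_represents: "sq_R q *v sq_coords p = sq_coords (p * q)"
  by (simp add: vec_eq_iff forall_4 matrix_vector_mult_def sum_4 sq_R_def sq_coords_def
      vector_4 times_split_quat_def algebra_simps)

end

theory Submission
  imports Defs
begin

text \<open>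
  A spacelike unit vector \<open>\<epsilon>\<close> satisfies \<open>\<epsilon>\<^sup>2 = 1\<close>, so in the commutative algebra
  spanned by \<open>1\<close> and \<open>\<epsilon>\<close> one has \<open>exp (\<theta>\<epsilon>) = cosh \<theta> + \<epsilon> sinh \<theta>\<close>, and the polar form
  \<open>sinh \<theta> + \<epsilon> cosh \<theta>\<close> is \<open>\<epsilon> exp (\<theta>\<epsilon>)\<close>. Its \<open>n\<close>-th power is \<open>\<epsilon>\<^sup>n exp (n\<theta>\<epsilon>)\<close>, where
  \<open>\<epsilon>\<^sup>n\<close> is \<open>\<epsilon>\<close> or \<open>1\<close> according to the parity of \<open>n\<close>; this is the source of the exchange
  of \<open>sinh\<close> and \<open>cosh\<close>. It is the content of \<open>polar_power\<close>, which takes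
  place in an arbitrary real algebra containing a square root of \<open>1\<close>.

  The matrix statement follows because both representations turn powers of quaternions
  into powers of matrices. For \<open>q \<mapsto> L\<^sub>q\<close>, which is multiplicative, this is immediate;
  \<open>q \<mapsto> R\<^sub>q\<close> reverses products, but the factors of a power commute. Since both maps are
  linear and unital, applying them to \<open>q\<^sup>n = N\<^sub>q\<^sup>n (a + b\<epsilon>)\<close> yields the result.
\<close>

text \<open>
  Multiplication by \<open>e exp (te)\<close> swaps the two coefficients, through the factor \<open>e\<close>, and
  adds \<open>t\<close> to the argument. The induction step is therefore the pair of addition formulas
  for \<open>sinh\<close> and \<open>cosh\<close>, in either parity.
\<close>

lemma polar_power:
  fixes e :: "'a::real_algebra_1" and t :: real
  assumes "e * e = 1"
  shows "(of_real (sinh t) + cosh t *\<^sub>R e) ^ n =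
    (if odd n then of_real (sinh (real n * t)) + cosh (real n * t) *\<^sub>R e
     else of_real (cosh (real n * t)) + sinh (real n * t) *\<^sub>R e)"
proof (induction n)
  case 0
  show ?case by simp
next
  case (Suc n)
  have mult: "(of_real a + b *\<^sub>R e) * (of_real c + d *\<^sub>R e)
      = of_real (a * c + b * d) + (a * d + b * c) *\<^sub>R e" for a b c d :: real
    using assms by (simp add: of_real_def algebra_simps)
  have arg: "real (Suc n) * t = t + real n * t"
    by (simp add: algebra_simps)
  show ?case
    unfolding power_Suc Suc arg sinh_add cosh_add
    by (simp add: mult add.commute)
qed

lemma power_scaleR:
  fixes x :: "'a::real_algebra_1"
  shows "(r *\<^sub>R x) ^ n = r ^ n *\<^sub>R x ^ n"
  by (induction n) (simp_all add: mult.commute)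

lemma pure_sq_square:
  assumes "spacelike_unit u"
  shows "pure_sq u * pure_sq u = 1"
  using assms
  by (simp add: spacelike_unit_def lorentz_inner_def pure_sq_eq split_quat_defs)

lemma spacelike_polar_power:
  assumes "spacelike_unit u"
    and "q = r *\<^sub>R (of_real (sinh \<theta>) + cosh \<theta> *\<^sub>R pure_sq u)"
  shows "q ^ n = r ^ n *\<^sub>R
    (if odd n then of_real (sinh (real n * \<theta>)) + cosh (real n * \<theta>) *\<^sub>R pure_sq u
     else of_real (cosh (real n * \<theta>)) + sinh (real n * \<theta>) *\<^sub>R pure_sq u)"
  by (simp only: assms(2) power_scaleR polar_power[OF pure_sq_square[OF assms(1)]])

lemma sq_L_mult: "sq_L (p * q) = sq_L p ** sq_L q"
  by (simp add: vec_eq_iff forall_4 matrix_matrix_mult_def sum_4 sq_L_def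
      vector_4 times_split_quat_def algebra_simps)

lemma sq_R_mult: "sq_R (p * q) = sq_R q ** sq_R p"
  by (simp add: vec_eq_iff forall_4 matrix_matrix_mult_def sum_4 sq_R_def
      vector_4 times_split_quat_def algebra_simps)

lemma sq_L_one: "sq_L 1 = mat 1"
  by (simp add: vec_eq_iff forall_4 mat_def sq_L_def vector_4 one_split_quat_def)

lemma sq_R_one: "sq_R 1 = mat 1"
  by (simp add: vec_eq_iff forall_4 mat_def sq_R_def vector_4 one_split_quat_def)

lemma matrix_power_sq_L: "matrix_power (sq_L q) n = sq_L (q ^ n)"
  by (induction n) (simp_all add: sq_L_one sq_L_mult)

lemma matrix_power_sq_R: "matrix_power (sq_R q) n = sq_R (q ^ n)"
proof (induction n)
  case 0
  show ?case by (simp add: sq_R_one)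
next
  case (Suc n)
  then show ?case
    \<comment> \<open>Splitting off the last factor of the power compensates the reversal of products.\<close>
    by (simp add: power_Suc2 sq_R_mult del: power_Suc)
qed

lemma sq_L_linear_form:
  "sq_L (r *\<^sub>R (of_real a + b *\<^sub>R p)) = r *\<^sub>R (a *\<^sub>R mat 1 + b *\<^sub>R sq_L p)"
  by (simp add: vec_eq_iff forall_4 mat_def sq_L_def vector_4 of_real_def
      split_quat_defs algebra_simps)

lemma sq_R_linear_form:
  "sq_R (r *\<^sub>R (of_real a + b *\<^sub>R p)) = r *\<^sub>R (a *\<^sub>R mat 1 + b *\<^sub>R sq_R p)"
  by (simp add: vec_eq_iff forall_4 mat_def sq_R_def vector_4 of_real_def
      split_quat_defs algebra_simps)

lemma sq_L_pure_entries:
  "a *\<^sub>R mat 1 + b *\<^sub>R sq_L (pure_sq u) = matrix44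
    [[a, - (u$1 * b), u$2 * b, u$3 * b],
     [u$1 * b, a, u$3 * b, - (u$2 * b)],
     [u$2 * b, u$3 * b, a, - (u$1 * b)],
     [u$3 * b, - (u$2 * b), u$1 * b, a]]"
  by (simp add: vec_eq_iff forall_4 mat_def sq_L_def vector_4 pure_sq_eq)

lemma sq_R_pure_entries:
  "a *\<^sub>R mat 1 + b *\<^sub>R sq_R (pure_sq u) = matrix44
    [[a, - (u$1 * b), u$2 * b, u$3 * b],
     [u$1 * b, a, - (u$3 * b), u$2 * b],
     [u$2 * b, - (u$3 * b), a, u$1 * b],
     [u$3 * b, u$2 * b, - (u$1 * b), a]]"
  by (simp add: vec_eq_iff forall_4 mat_def sq_R_def vector_4 pure_sq_eq)

theorem theorem5:
  fixes q :: split_quat and \<theta> :: real and u :: "real^3" and n :: nat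
  assumes "sq_spacelike q"
    and "spacelike_unit u"
    and "q = sq_N q *\<^sub>R (of_real (sinh \<theta>) + cosh \<theta> *\<^sub>R pure_sq u)"
    and "n > 0"
  shows "(odd n \<longrightarrow>
      matrix_power (sq_L q) n = sq_N q ^ n *\<^sub>R matrix44
          [[sinh (real n * \<theta>), - (u$1 * cosh (real n * \<theta>)), u$2 * cosh (real n * \<theta>), u$3 * cosh (real n * \<theta>)],
           [u$1 * cosh (real n * \<theta>), sinh (real n * \<theta>), u$3 * cosh (real n * \<theta>), - (u$2 * cosh (real n * \<theta>))],
           [u$2 * cosh (real n * \<theta>), u$3 * cosh (real n * \<theta>), sinh (real n * \<theta>), - (u$1 * cosh (real n * \<theta>))],
           [u$3 * cosh (real n * \<theta>), - (u$2 * cosh (real n * \<theta>)), u$1 * cosh (real n * \<theta>), sinh (real n * \<theta>)]] \<and>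
      matrix_power (sq_L q) n = sq_N q ^ n *\<^sub>R (sinh (real n * \<theta>) *\<^sub>R mat 1 + cosh (real n * \<theta>) *\<^sub>R sq_L (pure_sq u)) \<and>
      matrix_power (sq_R q) n = sq_N q ^ n *\<^sub>R matrix44
          [[sinh (real n * \<theta>), - (u$1 * cosh (real n * \<theta>)), u$2 * cosh (real n * \<theta>), u$3 * cosh (real n * \<theta>)],
           [u$1 * cosh (real n * \<theta>), sinh (real n * \<theta>), - (u$3 * cosh (real n * \<theta>)), u$2 * cosh (real n * \<theta>)],
           [u$2 * cosh (real n * \<theta>), - (u$3 * cosh (real n * \<theta>)), sinh (real n * \<theta>), u$1 * cosh (real n * \<theta>)],
           [u$3 * cosh (real n * \<theta>), u$2 * cosh (real n * \<theta>), - (u$1 * cosh (real n * \<theta>)), sinh (real n * \<theta>)]] \<and>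
      matrix_power (sq_R q) n = sq_N q ^ n *\<^sub>R (sinh (real n * \<theta>) *\<^sub>R mat 1 + cosh (real n * \<theta>) *\<^sub>R sq_R (pure_sq u))) \<and>
    (even n \<longrightarrow>
      matrix_power (sq_L q) n = sq_N q ^ n *\<^sub>R matrix44
          [[cosh (real n * \<theta>), - (u$1 * sinh (real n * \<theta>)), u$2 * sinh (real n * \<theta>), u$3 * sinh (real n * \<theta>)],
           [u$1 * sinh (real n * \<theta>), cosh (real n * \<theta>), u$3 * sinh (real n * \<theta>), - (u$2 * sinh (real n * \<theta>))],
           [u$2 * sinh (real n * \<theta>), u$3 * sinh (real n * \<theta>), cosh (real n * \<theta>), - (u$1 * sinh (real n * \<theta>))],
           [u$3 * sinh (real n * \<theta>), - (u$2 * sinh (real n * \<theta>)), u$1 * sinh (real n * \<theta>), cosh (real n * \<theta>)]] \<and>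
      matrix_power (sq_L q) n = sq_N q ^ n *\<^sub>R (cosh (real n * \<theta>) *\<^sub>R mat 1 + sinh (real n * \<theta>) *\<^sub>R sq_L (pure_sq u)) \<and>
      matrix_power (sq_R q) n = sq_N q ^ n *\<^sub>R matrix44
          [[cosh (real n * \<theta>), - (u$1 * sinh (real n * \<theta>)), u$2 * sinh (real n * \<theta>), u$3 * sinh (real n * \<theta>)],
           [u$1 * sinh (real n * \<theta>), cosh (real n * \<theta>), - (u$3 * sinh (real n * \<theta>)), u$2 * sinh (real n * \<theta>)],
           [u$2 * sinh (real n * \<theta>), - (u$3 * sinh (real n * \<theta>)), cosh (real n * \<theta>), u$1 * sinh (real n * \<theta>)],
           [u$3 * sinh (real n * \<theta>), u$2 * sinh (real n * \<theta>), - (u$1 * sinh (real n * \<theta>)), cosh (real n * \<theta>)]] \<and>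
      matrix_power (sq_R q) n = sq_N q ^ n *\<^sub>R (cosh (real n * \<theta>) *\<^sub>R mat 1 + sinh (real n * \<theta>) *\<^sub>R sq_R (pure_sq u)))"
proof -
  note power = spacelike_polar_power[OF assms(2,3), of n]
  have "matrix_power (sq_L q) n = sq_N q ^ n *\<^sub>R
      (sinh (real n * \<theta>) *\<^sub>R mat 1 + cosh (real n * \<theta>) *\<^sub>R sq_L (pure_sq u))"
    and "matrix_power (sq_R q) n = sq_N q ^ n *\<^sub>R
      (sinh (real n * \<theta>) *\<^sub>R mat 1 + cosh (real n * \<theta>) *\<^sub>R sq_R (pure_sq u))"
    if "odd n"
    using power that
    by (simp_all only: matrix_power_sq_L matrix_power_sq_R sq_L_linear_form
        sq_R_linear_form not_False_eq_True if_True)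
  moreover have "matrix_power (sq_L q) n = sq_N q ^ n *\<^sub>R
      (cosh (real n * \<theta>) *\<^sub>R mat 1 + sinh (real n * \<theta>) *\<^sub>R sq_L (pure_sq u))"
    and "matrix_power (sq_R q) n = sq_N q ^ n *\<^sub>R
      (cosh (real n * \<theta>) *\<^sub>R mat 1 + sinh (real n * \<theta>) *\<^sub>R sq_R (pure_sq u))"
    if "even n"
    using power that
    by (simp_all only: matrix_power_sq_L matrix_power_sq_R sq_L_linear_form
        sq_R_linear_form not_True_eq_False if_False)
  ultimately show ?thesis
    unfolding sq_L_pure_entries sq_R_pure_entries by blast
qed

end
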